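(* Fix a maximum filtration $\tau_{max}>0$ and a positive integer $N$. The Betti sequence $\vec v$ (computed with $N$ subintervals of $[0,\tau_{max}]$) is not stable with respect to the $1$-Wasserstein distance. That is, there does not exist a constant $C\ge 0$ such that $$\|\vec v(B)-\vec v(B')\|_\infty \le C\cdot W_1(B,B')$$ for all persistence diagrams $B,B'$ with finitely many off-diagonal points and maximum filtration $\tau_{max}$. Equivalently, for every $C\ge 0$ there exist such persistence diagrams $B$ and $B'$ with $\|\vec v(B)-\vec v(B')\|_\infty > C\cdot W_1(B,B')$.
   Context: Persistence diagram: here, a finite multiset of off-diagonal (birth, death) points $(b,d)\in\mathbb{R}^2$ with $0\le b<d\le\tau_{max}$, where $\tau_{max}$ is the maximum filtration. By the usual convention, all points of the diagonal $\Delta=\{(t,t)\}$ are additionally available for matchings, with infinite multiplicity. Betti sequence: divide $[0,\tau_{max}]$ into $N$ equal subintervals $[\tau_{i-1},\tau_i]$, $1\le i\le N$, with $\tau_i=i\,\tau_{max}/N$. For each $i$ let $D_i=K_i\setminus C_i$, where $$K_i=\{(b,d)\in\mathbb{R}^2 : 0<b<\tau_i,\ d>\tau_{i-1}\},\qquad C_i=\{(b,d)\in\mathbb{R}^2 : \tau_{i-1}\le b\le\tau_i,\ \tau_{i-1}<d<b\}.$$ The Betti sequence of $B$ is $\vec v(B)=(v_1,\dots,v_N)\in\mathbb{R}^N$, where $v_i=|D_i\cap B|$ is the number of off-diagonal points of $B$ lying in $D_i$, counted with multiplicity. $1$-Wasserstein distance: $$W_1(B,B')=\inf_{\eta}\sum_{x}\|x-\eta(x)\|_\infty,$$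 where $\eta$ ranges over partial matchings of $B$ and $B'$. Each off-diagonal point of $B$ is matched either to an off-diagonal point of $B'$ or to a point of the diagonal, and each off-diagonal point of $B'$ not matched to an off-diagonal point of $B$ is matched to a point of the diagonal. The sum is over all matched pairs, including those with one point on the diagonal. Here $\|\cdot\|_\infty$ is the sup norm on $\mathbb{R}^2$ (and on $\mathbb{R}^N$ for the Betti sequences). *)

theory Defs
  imports "HOL-Analysis.Analysis" "HOL-Library.Multiset"
begin

type_synonym point = "real \<times> real"

definition diagonal :: "point set" where
  "diagonal = {(t, t) | t. True}"

text \<open>
  A persistence diagram is represented by the multiset of its off-diagonal points
  (multisets are finite by type). The points of the diagonal are not stored; they
  become available in partial matchings.
\<close>
definition persistence_diagram :: "real \<Rightarrow> point multiset \<Rightarrow> bool" where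
  "persistence_diagram \<tau>max B \<longleftrightarrow> (\<forall>(b, d) \<in># B. 0 \<le> b \<and> b < d \<and> d \<le> \<tau>max)"

definition \<tau> :: "real \<Rightarrow> nat \<Rightarrow> nat \<Rightarrow> real" where
  "\<tau> \<tau>max N i = real i * \<tau>max / real N"

text \<open>The three regions below are only used for \<open>1 \<le> i \<le> N\<close>, so \<open>i - 1\<close> does not truncate.\<close>

definition K_region :: "real \<Rightarrow> nat \<Rightarrow> nat \<Rightarrow> point set" where
  "K_region \<tau>max N i = {(b, d). 0 < b \<and> b < \<tau> \<tau>max N i \<and> d > \<tau> \<tau>max N (i - 1)}"

definition C_region :: "real \<Rightarrow> nat \<Rightarrow> nat \<Rightarrow> point set" where
  "C_region \<tau>max N i =
     {(b, d). \<tau> \<tau>max N (i - 1) \<le> b \<and> b \<le> \<tau> \<tau>max N i \<and> \<tau> \<tau>max N (i - 1) < d \<and> d < b}"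

definition D_region :: "real \<Rightarrow> nat \<Rightarrow> nat \<Rightarrow> point set" where
  "D_region \<tau>max N i = K_region \<tau>max N i - C_region \<tau>max N i"

text \<open>
  Vectors in \<open>\<real>\<^sup>N\<close> are functions on \<open>nat\<close> of which only the entries with index in \<open>{1..N}\<close>
  are meaningful.
\<close>
definition betti_sequence :: "real \<Rightarrow> nat \<Rightarrow> point multiset \<Rightarrow> nat \<Rightarrow> real" where
  "betti_sequence \<tau>max N B i = real (size {#p \<in># B. p \<in> D_region \<tau>max N i#})"

definition sup_norm :: "nat \<Rightarrow> (nat \<Rightarrow> real) \<Rightarrow> real" where
  "sup_norm N v = Max ((\<lambda>i. \<bar>v i\<bar>) ` {1..N})"

text \<open>
  A partial matching is the multiset of its matched pairs \<open>(x, y)\<close>. Every off-diagonal point of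
  \<open>B\<close> (resp. \<open>B'\<close>) occurs, with its multiplicity, exactly once as a first (resp. second)
  component; all other components are diagonal points, usable arbitrarily often, and no diagonal
  point is matched to a diagonal point.
\<close>
definition partial_matching ::
  "point multiset \<Rightarrow> point multiset \<Rightarrow> (point \<times> point) multiset \<Rightarrow> bool" where
  "partial_matching B B' \<eta> \<longleftrightarrow>
     {#x \<in># image_mset fst \<eta>. x \<notin> diagonal#} = B \<and>
     {#y \<in># image_mset snd \<eta>. y \<notin> diagonal#} = B' \<and>
     (\<forall>(x, y) \<in># \<eta>. x \<notin> diagonal \<or> y \<notin> diagonal)"

text \<open>On \<open>real \<times> real\<close>, \<^const>\<open>infnorm\<close> is the sup norm, whereas \<^const>\<open>norm\<close> would be Euclidean.\<close>

definition matching_cost :: "(point \<times> point) multiset \<Rightarrow> real" where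
  "matching_cost \<eta> = (\<Sum>(x, y) \<in># \<eta>. infnorm (x - y))"

definition wasserstein1 :: "point multiset \<Rightarrow> point multiset \<Rightarrow> real" where
  "wasserstein1 B B' = (INF \<eta> \<in> {\<eta>. partial_matching B B' \<eta>}. matching_cost \<eta>)"

text \<open>
  The infimum defining \<^const>\<open>wasserstein1\<close> is a genuine one: it is taken over a nonempty set of
  nonnegative reals.
\<close>

lemma matching_cost_nonneg: "0 \<le> matching_cost \<eta>"
  by (induction \<eta>) (auto simp: matching_cost_def infnorm_pos_le)

lemma partial_matching_exists:
  assumes "persistence_diagram \<tau>max B" and "persistence_diagram \<tau>max B'"
  shows "\<exists>\<eta>. partial_matching B B' \<eta>"
proof -
  have off: "x \<notin> diagonal" if "x \<in># B \<or> x \<in># B'" for x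
    using that assms by (fastforce simp: persistence_diagram_def diagonal_def)
  have zero: "(0, 0) \<in> diagonal"
    by (simp add: diagonal_def)
  have keep: "{#x \<in># B. x \<notin> diagonal#} = B" "{#x \<in># B'. x \<notin> diagonal#} = B'"
    using off by (simp_all add: filter_mset_eq_conv)
  have drop: "{#x \<in># image_mset (\<lambda>_. (0, 0)) A. x \<notin> diagonal#} = {#}" for A :: "point multiset"
    using zero by (induction A) auto
  have "partial_matching B B'
      (image_mset (\<lambda>x. (x, (0, 0))) B + image_mset (\<lambda>y. ((0, 0), y)) B')"
    using off by (auto simp: partial_matching_def image_mset.compositionality o_def keep drop)
  then show ?thesis by blast
qed

end

theory Submission imports Defs
begin

text \<open>
  Entries of the Betti sequence count points, so they jump by a whole unit however close to the
  diagonal the point in question is; the Wasserstein distance, in contrast, charges for creating a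
  point only its distance to the diagonal. Comparing the empty diagram with the diagram whose
  single point \<open>(b, b + \<epsilon>)\<close> is born inside the first subinterval, the Betti sequences differ by
  at least \<open>1\<close> (lemma \<open>sup_norm_betti_point_ge_1\<close>) while the distance is at most \<open>\<epsilon>\<close>
  (lemma \<open>wasserstein1_short_bar_le\<close>). Any \<open>\<epsilon>\<close> with \<open>C * \<epsilon> < 1\<close> therefore defeats the
  constant \<open>C\<close>.
\<close>

lemma wasserstein1_le_matching_cost:
  assumes "partial_matching B B' \<eta>"
  shows "wasserstein1 B B' \<le> matching_cost \<eta>"
  unfolding wasserstein1_def
proof (rule cINF_lower)
  show "bdd_below (matching_cost ` {\<eta>. partial_matching B B' \<eta>})"
    by (rule bdd_belowI2[where m = 0]) (rule matching_cost_nonneg)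
qed (use assms in simp)

text \<open>
  The bound comes from matching the point vertically with \<open>(b, b)\<close>. The midpoint
  \<open>(b + \<epsilon> / 2, b + \<epsilon> / 2)\<close> would give the sharp value \<open>\<epsilon> / 2\<close>.
\<close>
lemma wasserstein1_short_bar_le:
  assumes "\<epsilon> > 0"
  shows "wasserstein1 {#(b, b + \<epsilon>)#} {#} \<le> \<epsilon>"
proof -
  let ?\<eta> = "{#((b, b + \<epsilon>), (b, b))#}"
  have "partial_matching {#(b, b + \<epsilon>)#} {#} ?\<eta>"
    using assms by (auto simp: partial_matching_def diagonal_def)
  then have "wasserstein1 {#(b, b + \<epsilon>)#} {#} \<le> matching_cost ?\<eta>"
    by (rule wasserstein1_le_matching_cost)
  also have "\<dots> = infnorm ((0, \<epsilon>) :: point)"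
    by (simp add: matching_cost_def)
  also have "\<dots> \<le> norm ((0, \<epsilon>) :: point)"
    by (rule infnorm_le_norm)
  also have "\<dots> = \<epsilon>"
    using assms by (simp add: norm_Pair)
  finally show ?thesis .
qed

lemma abs_le_sup_norm:
  assumes "i \<in> {1..N}"
  shows "\<bar>v i\<bar> \<le> sup_norm N v"
  unfolding sup_norm_def using assms by (intro Max_ge) auto

text \<open>
  The first entry counts \<open>(b, d)\<close>: the point is born inside the first subinterval and, lying above
  the diagonal, avoids the region cut out of \<open>K\<close>, which lies strictly below it.
\<close>
lemma sup_norm_betti_point_ge_1:
  assumes "N \<ge> 1" and "0 < b" and "b < \<tau>max / real N" and "b < d"
  shows "1 \<le> sup_norm N (\<lambda>i. betti_sequence \<tau>max N {#(b, d)#} i - betti_sequence \<tau>max N {#} i)"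
    (is "1 \<le> sup_norm N ?v")
proof -
  have "(b, d) \<in> D_region \<tau>max N 1"
    using assms by (simp add: D_region_def K_region_def C_region_def \<tau>_def)
  then have "?v 1 = 1"
    by (simp add: betti_sequence_def)
  moreover have "\<bar>?v 1\<bar> \<le> sup_norm N ?v"
    using assms(1) by (intro abs_le_sup_norm) simp
  ultimately show ?thesis by simp
qed

lemma betti_sequence_unstable:
  fixes \<tau>max C :: real and N :: nat
  assumes "\<tau>max > 0" and "N \<ge> 1" and "C \<ge> 0"
  shows "\<exists>B B'. persistence_diagram \<tau>max B \<and> persistence_diagram \<tau>max B' \<and>
           C * wasserstein1 B B'
             < sup_norm N (\<lambda>i. betti_sequence \<tau>max N B i - betti_sequence \<tau>max N B' i)"
proof -
  \<comment> \<open>The birth is the midpoint of the first subinterval, hence at most \<open>\<tau>max / 2\<close> even for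
      \<open>N = 1\<close>; this leaves room for a lifetime of up to \<open>\<tau>max / 2\<close>.\<close>
  define b where "b = \<tau>max / (2 * real N)"
  define \<epsilon> where "\<epsilon> = min (\<tau>max / 2) (1 / (C + 1))"
  have b: "0 < b" "b < \<tau>max / real N" "b \<le> \<tau>max / 2"
    using assms by (auto simp: b_def field_simps)
  have \<epsilon>: "0 < \<epsilon>" "\<epsilon> \<le> \<tau>max / 2" "\<epsilon> \<le> 1 / (C + 1)"
    using assms by (auto simp: \<epsilon>_def)
  let ?B = "{#(b, b + \<epsilon>)#}"
  have "persistence_diagram \<tau>max ?B" and "persistence_diagram \<tau>max {#}"
    using b \<epsilon> by (auto simp: persistence_diagram_def)
  moreover have "C * wasserstein1 ?B {#}
      < sup_norm N (\<lambda>i. betti_sequence \<tau>max N ?B i - betti_sequence \<tau>max N {#} i)"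
  proof -
    have "C * wasserstein1 ?B {#} \<le> C * \<epsilon>"
      using wasserstein1_short_bar_le[OF \<epsilon>(1)] assms(3) by (rule mult_left_mono)
    also have "\<dots> \<le> C * (1 / (C + 1))"
      using \<epsilon>(3) assms(3) by (rule mult_left_mono)
    also have "\<dots> < 1"
      using assms(3) by (simp add: field_simps)
    also have "1 \<le> sup_norm N
        (\<lambda>i. betti_sequence \<tau>max N ?B i - betti_sequence \<tau>max N {#} i)"
      using assms(2) b(1,2) \<epsilon>(1) by (intro sup_norm_betti_point_ge_1) auto
    finally show ?thesis .
  qed
  ultimately show ?thesis by blast
qed

theorem theorem2p5:
  fixes \<tau>max :: real and N :: nat
  assumes "\<tau>max > 0" and "N \<ge> 1"
  shows "\<not> (\<exists>C::real. C \<ge> 0 \<and>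
            (\<forall>B B'. persistence_diagram \<tau>max B \<longrightarrow> persistence_diagram \<tau>max B' \<longrightarrow>
               sup_norm N (\<lambda>i. betti_sequence \<tau>max N B i - betti_sequence \<tau>max N B' i)
                 \<le> C * wasserstein1 B B'))
       \<and> (\<forall>C::real. C \<ge> 0 \<longrightarrow>
            (\<exists>B B'. persistence_diagram \<tau>max B \<and> persistence_diagram \<tau>max B' \<and>
               sup_norm N (\<lambda>i. betti_sequence \<tau>max N B i - betti_sequence \<tau>max N B' i)
                 > C * wasserstein1 B B'))"
  using betti_sequence_unstable[OF assms] by (meson not_le)

end
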